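(* The ai-semirings $\mathcal{A}_2^1$ and $\mathrm{End}(\mathcal{C}_3)$ admit no finite identity basis.
   Context: An ai-semiring is a structure $(R,+,\cdot)$ with $(R,+)$ a semilattice, $(R,\cdot)$ a semigroup, and multiplication distributing over addition on both sides. $\mathcal{C}_3$ is the chain $0<1<2$ viewed as a semilattice with $k+\ell=\max\{k,\ell\}$; $\mathrm{End}(\mathcal{C}_3)$ is the set of its endomorphisms (order-preserving self-maps of $\{0,1,2\}$) with pointwise addition $x(\alpha+\beta)=x\alpha+x\beta$ and composition $x(\alpha\beta)=(x\alpha)\beta$. $\mathcal{A}_2^1$ is the subsemiring of $\mathrm{End}(\mathcal{C}_3)$ consisting of all endomorphisms fixing $2$; as a monoid it is $A_2^1$, where $A_2=\langle e,a\mid eae=e^2=e,\ aea=a,\ a^2=0\rangle$ with an identity adjoined. An identity basis is a set of identities valid in the structure from which all its identities follow. *)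

theory Defs
  imports Main
begin

datatype trm = Var nat | Plus trm trm | Times trm trm

type_synonym identity = "trm \<times> trm"

fun subst :: "(nat \<Rightarrow> trm) \<Rightarrow> trm \<Rightarrow> trm" where
  "subst \<sigma> (Var i) = \<sigma> i"
| "subst \<sigma> (Plus s t) = Plus (subst \<sigma> s) (subst \<sigma> t)"
| "subst \<sigma> (Times s t) = Times (subst \<sigma> s) (subst \<sigma> t)"

inductive derivable :: "identity set \<Rightarrow> identity \<Rightarrow> bool" for \<Sigma> where
  ax:    "(s, t) \<in> \<Sigma> \<Longrightarrow> derivable \<Sigma> (subst \<sigma> s, subst \<sigma> t)"
| refl:  "derivable \<Sigma> (t, t)"
| sym:   "derivable \<Sigma> (s, t) \<Longrightarrow> derivable \<Sigma> (t, s)"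
| trans: "derivable \<Sigma> (s, t) \<Longrightarrow> derivable \<Sigma> (t, u) \<Longrightarrow> derivable \<Sigma> (s, u)"
| plus:  "derivable \<Sigma> (s, s') \<Longrightarrow> derivable \<Sigma> (t, t') \<Longrightarrow> derivable \<Sigma> (Plus s t, Plus s' t')"
| times: "derivable \<Sigma> (s, s') \<Longrightarrow> derivable \<Sigma> (t, t') \<Longrightarrow> derivable \<Sigma> (Times s t, Times s' t')"

fun eval :: "('a \<Rightarrow> 'a \<Rightarrow> 'a) \<Rightarrow> ('a \<Rightarrow> 'a \<Rightarrow> 'a) \<Rightarrow> (nat \<Rightarrow> 'a) \<Rightarrow> trm \<Rightarrow> 'a" where
  "eval ad mu \<rho> (Var i) = \<rho> i"
| "eval ad mu \<rho> (Plus s t) = ad (eval ad mu \<rho> s) (eval ad mu \<rho> t)"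
| "eval ad mu \<rho> (Times s t) = mu (eval ad mu \<rho> s) (eval ad mu \<rho> t)"

definition holds_in :: "'a set \<Rightarrow> ('a \<Rightarrow> 'a \<Rightarrow> 'a) \<Rightarrow> ('a \<Rightarrow> 'a \<Rightarrow> 'a) \<Rightarrow> identity \<Rightarrow> bool" where
  "holds_in S ad mu e \<longleftrightarrow>
     (\<forall>\<rho>. (\<forall>i. \<rho> i \<in> S) \<longrightarrow> eval ad mu \<rho> (fst e) = eval ad mu \<rho> (snd e))"

definition finitely_based :: "'a set \<Rightarrow> ('a \<Rightarrow> 'a \<Rightarrow> 'a) \<Rightarrow> ('a \<Rightarrow> 'a \<Rightarrow> 'a) \<Rightarrow> bool" where
  "finitely_based S ad mu \<longleftrightarrow>
     (\<exists>\<Sigma>. finite \<Sigma> \<and> (\<forall>e\<in>\<Sigma>. holds_in S ad mu e) \<and>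
          (\<forall>e. holds_in S ad mu e \<longrightarrow> derivable \<Sigma> e))"

text \<open>An endomorphism of the chain 0<1<2 is represented as a function nat => nat that is
  order-preserving on {0,1,2}, maps {0,1,2} into {0,1,2}, and is 0 outside {0,1,2}
  (normalisation making the representation unique).\<close>

definition EndC3 :: "(nat \<Rightarrow> nat) set" where
  "EndC3 = {f. (\<forall>x\<le>2. f x \<le> 2) \<and> (\<forall>x y. x \<le> y \<and> y \<le> 2 \<longrightarrow> f x \<le> f y) \<and> (\<forall>x>2. f x = 0)}"

definition end_add :: "(nat \<Rightarrow> nat) \<Rightarrow> (nat \<Rightarrow> nat) \<Rightarrow> (nat \<Rightarrow> nat)" where
  "end_add f g = (\<lambda>x. max (f x) (g x))"

definition end_mul :: "(nat \<Rightarrow> nat) \<Rightarrow> (nat \<Rightarrow> nat) \<Rightarrow> (nat \<Rightarrow> nat)" where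
  "end_mul f g = (\<lambda>x. if x \<le> 2 then g (f x) else 0)"

definition A21 :: "(nat \<Rightarrow> nat) set" where
  "A21 = {f \<in> EndC3. f 2 = 2}"

end

theory Submission
  imports Defs
begin

text \<open>
  A term is a sum of words, so an identity amounts to inequalities \<open>w \<le> u\<^sub>1 + \<dots> + u\<^sub>k\<close> between words.
  In A21 such an inequality says that whenever letters \<open>x\<close>, \<open>y\<close> occur in \<open>w\<close> in this order, they
  also do so in some \<open>u\<^sub>i\<close>, with no other letters between them than in \<open>w\<close> (with similar conditions
  on prefixes and on the content). A finite set of identities replaces only boundedly many words at
  a time. Hence it suffices to find, for each \<open>N\<close>, a set \<open>U\<close> of words above a word not in \<open>U\<close>
  such that consequences of \<open>N\<close> words stay under control. With \<open>Y = x\<^sub>0 \<dots> x\<^sub>m\<^sub>-\<^sub>1\<close> the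
  inequality is
  \<open>Y Y \<le> Y + \<Sum>\<^sub>j\<^sub>\<le>\<^sub>i a\<^sub>i\<^sub>j x\<^sub>i x\<^sub>m\<^sub>-\<^sub>1 x\<^sub>0 x\<^sub>j\<close>, which even holds in EndC3: the private letter \<open>a\<^sub>i\<^sub>j\<close>
  makes its word rigid, and each summand is responsible for a single pair \<open>x\<^sub>i \<dots> x\<^sub>j\<close>.
\<close>

section \<open>Terms as sets of words\<close>

text \<open>The value of a term in the free ai-semiring, whose elements are the finite nonempty sets
  of nonempty words.\<close>

fun words :: "trm \<Rightarrow> nat list set" where
  "words (Var i) = {[i]}"
| "words (Plus s t) = words s \<union> words t"
| "words (Times s t) = (\<lambda>(u, v). u @ v) ` (words s \<times> words t)"

lemma finite_words: "finite (words t)"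
  by (induction t) auto

lemma words_nonempty: "words t \<noteq> {}"
  by (induction t) auto

lemma Nil_notin_words: "[] \<notin> words t"
  by (induction t) auto

lemma ex_term_word: "w \<noteq> [] \<Longrightarrow> \<exists>t. words t = {w}"
proof (induction w rule: list_nonempty_induct)
  case (single x)
  then show ?case by (intro exI[of _ "Var x"]) simp
next
  case (cons x xs)
  then obtain t where "words t = {xs}" by blast
  then show ?case by (intro exI[of _ "Times (Var x) t"]) simp
qed

lemma ex_term_words:
  assumes "finite U" "U \<noteq> {}" "[] \<notin> U"
  shows "\<exists>t. words t = U"
  using assms
proof (induction U rule: finite_ne_induct)
  case (singleton w)
  then show ?case using ex_term_word by simp
next
  case (insert w U)
  then obtain s t where "words s = {w}" "words t = U" using ex_term_word by (metis insertCI)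
  then show ?case by (intro exI[of _ "Plus s t"]) simp
qed

section \<open>Substitution instances and their subsets with few words\<close>

lemma words_subst_mono:
  assumes "\<And>i. words (\<sigma> i) \<subseteq> words (\<tau> i)"
  shows "words (subst \<sigma> t) \<subseteq> words (subst \<tau> t)"
  by (induction t) (use assms in auto)

fun leaves :: "trm \<Rightarrow> nat" where
  "leaves (Var i) = 1"
| "leaves (Plus s t) = leaves s + leaves t"
| "leaves (Times s t) = leaves s + leaves t"

text \<open>Independent of the substitution, so that finitely many identities share one
  bound.\<close>

fun words_bound :: "nat \<Rightarrow> trm \<Rightarrow> nat" where
  "words_bound c (Var i) = c"
| "words_bound c (Plus s t) = words_bound c s + words_bound c t"
| "words_bound c (Times s t) = words_bound c s * words_bound c t"

lemma card_words_subst_le: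
  assumes "\<And>i. card (words (\<sigma> i)) \<le> c"
  shows "card (words (subst \<sigma> t)) \<le> words_bound c t"
proof (induction t)
  case (Var i)
  then show ?case using assms by simp
next
  case (Plus s t)
  then show ?case
    using card_Un_le[of "words (subst \<sigma> s)" "words (subst \<sigma> t)"] by simp
next
  case (Times s t)
  have "card (words (subst \<sigma> (Times s t)))
      \<le> card (words (subst \<sigma> s) \<times> words (subst \<sigma> t))"
    using card_image_le[of "words (subst \<sigma> s) \<times> words (subst \<sigma> t)"]
    by (simp add: finite_words del: card_cartesian_product)
  also have "\<dots> \<le> words_bound c (Times s t)"
    using Times by (simp add: card_cartesian_product mult_le_mono)
  finally show ?case .
qed

text \<open>Forming \<open>v\<close> takes at most one word of \<open>\<sigma> i\<close> for each
  leaf, so all other words can be discarded.\<close>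

lemma words_subst_local:
  assumes "v \<in> words (subst \<sigma> t)"
  shows "\<exists>\<tau>. (\<forall>i. words (\<tau> i) \<subseteq> words (\<sigma> i) \<and> card (words (\<tau> i)) \<le> leaves t)
              \<and> v \<in> words (subst \<tau> t)"
proof -
  have combine: "\<exists>\<tau>. (\<forall>i. words (\<tau> i) \<subseteq> words (\<sigma> i) \<and> card (words (\<tau> i)) \<le> a + b)
      \<and> u \<in> words (subst \<tau> s) \<and> v \<in> words (subst \<tau> t)"
    if "\<forall>i. words (\<tau>1 i) \<subseteq> words (\<sigma> i) \<and> card (words (\<tau>1 i)) \<le> a" "u \<in> words (subst \<tau>1 s)"
      "\<forall>i. words (\<tau>2 i) \<subseteq> words (\<sigma> i) \<and> card (words (\<tau>2 i)) \<le> b" "v \<in> words (subst \<tau>2 t)"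
    for \<tau>1 \<tau>2 a b u v s t
  proof (intro exI[of _ "\<lambda>i. Plus (\<tau>1 i) (\<tau>2 i)"] conjI allI)
    fix i
    show "words (Plus (\<tau>1 i) (\<tau>2 i)) \<subseteq> words (\<sigma> i)" using that by auto
    show "card (words (Plus (\<tau>1 i) (\<tau>2 i))) \<le> a + b"
      using card_Un_le[of "words (\<tau>1 i)" "words (\<tau>2 i)"] that(1,3)
      by simp (meson add_mono le_trans)
  next
    show "u \<in> words (subst (\<lambda>i. Plus (\<tau>1 i) (\<tau>2 i)) s)"
      using that(2) words_subst_mono[of \<tau>1 "\<lambda>i. Plus (\<tau>1 i) (\<tau>2 i)" s] by auto
    show "v \<in> words (subst (\<lambda>i. Plus (\<tau>1 i) (\<tau>2 i)) t)"
      using that(4) words_subst_mono[of \<tau>2 "\<lambda>i. Plus (\<tau>1 i) (\<tau>2 i)" t] by auto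
  qed
  \<comment> \<open>The word set of a term is never empty, so every variable other than
    \<open>j\<close> keeps an arbitrary word.\<close>
  have single: "\<exists>\<tau>. \<forall>i. words (\<tau> i) \<subseteq> words (\<sigma> i) \<and> card (words (\<tau> i)) = 1 \<and>
      (i = j \<longrightarrow> words (\<tau> i) = {w})" if w: "w \<in> words (\<sigma> j)" for w j
  proof (rule choice, rule allI)
    fix i
    obtain w' where w': "w' \<in> words (\<sigma> i)" "i = j \<longrightarrow> w' = w"
      using words_nonempty[of "\<sigma> i"] w by (cases "i = j") auto
    then obtain t where "words t = {w'}"
      using ex_term_word[of w'] Nil_notin_words[of "\<sigma> i"] by metis
    then show "\<exists>t. words t \<subseteq> words (\<sigma> i) \<and> card (words t) = 1 \<and> (i = j \<longrightarrow> words t = {w})"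
      using w' by (intro exI[of _ t]) auto
  qed
  show ?thesis
    using assms
  proof (induction t arbitrary: v)
    case (Var j)
    then obtain \<tau> where \<tau>: "\<forall>i. words (\<tau> i) \<subseteq> words (\<sigma> i) \<and> card (words (\<tau> i)) = 1 \<and>
        (i = j \<longrightarrow> words (\<tau> i) = {v})"
      using single[of v j] by auto
    then show ?case by (intro exI[of _ \<tau>] conjI allI) auto
  next
    case (Plus s t)
    \<comment> \<open>\<open>v\<close> may come from one summand only; an arbitrary word of the
      other lets \<open>combine\<close> apply.\<close>
    obtain u where "u \<in> words (subst \<sigma> s)" using words_nonempty by blast
    moreover obtain u' where "u' \<in> words (subst \<sigma> t)" using words_nonempty by blast
    moreover have "v \<in> words (subst \<sigma> s) \<or> v \<in> words (subst \<sigma> t)" using Plus.prems by simp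
    ultimately obtain u1 u2 where u: "u1 \<in> words (subst \<sigma> s)" "u2 \<in> words (subst \<sigma> t)"
      "v = u1 \<or> v = u2" by blast
    obtain \<tau>1 \<tau>2 where
      "\<forall>i. words (\<tau>1 i) \<subseteq> words (\<sigma> i) \<and> card (words (\<tau>1 i)) \<le> leaves s" "u1 \<in> words (subst \<tau>1 s)"
      "\<forall>i. words (\<tau>2 i) \<subseteq> words (\<sigma> i) \<and> card (words (\<tau>2 i)) \<le> leaves t" "u2 \<in> words (subst \<tau>2 t)"
      using Plus.IH(1)[OF u(1)] Plus.IH(2)[OF u(2)] by blast
    from combine[OF this] show ?case using u(3) by auto
  next
    case (Times s t)
    then obtain u1 u2 where u: "u1 \<in> words (subst \<sigma> s)" "u2 \<in> words (subst \<sigma> t)" "v = u1 @ u2"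
      by auto
    obtain \<tau>1 \<tau>2 where
      "\<forall>i. words (\<tau>1 i) \<subseteq> words (\<sigma> i) \<and> card (words (\<tau>1 i)) \<le> leaves s" "u1 \<in> words (subst \<tau>1 s)"
      "\<forall>i. words (\<tau>2 i) \<subseteq> words (\<sigma> i) \<and> card (words (\<tau>2 i)) \<le> leaves t" "u2 \<in> words (subst \<tau>2 t)"
      using Times.IH(1)[OF u(1)] Times.IH(2)[OF u(2)] by blast
    from combine[OF this] obtain \<tau> where
      "\<forall>i. words (\<tau> i) \<subseteq> words (\<sigma> i) \<and> card (words (\<tau> i)) \<le> leaves s + leaves t"
      "u1 \<in> words (subst \<tau> s)" "u2 \<in> words (subst \<tau> t)" by blast
    then show ?case using u(3) by (intro exI[of _ \<tau>] conjI) auto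
  qed
qed

text \<open>An invariant of derivations need only be checked on substitution instances of the
  axioms. All contexts are treated at once because in a product the words of one factor join the
  context of the other.\<close>

lemma derivable_context_invariant:
  assumes axioms: "\<And>s t \<sigma> p q. (s, t) \<in> \<Sigma> \<Longrightarrow>
      (\<forall>w\<in>words (subst \<sigma> s). p @ w @ q \<in> P) = (\<forall>w\<in>words (subst \<sigma> t). p @ w @ q \<in> P)"
    and "derivable \<Sigma> e"
  shows "(\<forall>w\<in>words (fst e). p @ w @ q \<in> P) = (\<forall>w\<in>words (snd e). p @ w @ q \<in> P)"
  using assms(2)
proof (induction arbitrary: p q rule: derivable.induct)
  case (ax s t \<sigma>)
  then show ?case using axioms by simp
next
  case (plus s s' t t')
  then show ?case by (simp add: ball_Un)
next
  case (times s s' t t')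
  have split: "(\<forall>w\<in>words (Times a b). p @ w @ q \<in> P)
      = (\<forall>u\<in>words a. \<forall>v\<in>words b. p @ u @ v @ q \<in> P)" for a b
    by auto
  have "(\<forall>u\<in>words s. \<forall>v\<in>words t. p @ u @ v @ q \<in> P)
      = (\<forall>u\<in>words s. \<forall>v\<in>words t'. p @ u @ v @ q \<in> P)"
    using times.IH(2)[of "p @ _" q] by simp
  also have "\<dots> = (\<forall>v\<in>words t'. \<forall>u\<in>words s. p @ u @ v @ q \<in> P)" by blast
  also have "\<dots> = (\<forall>v\<in>words t'. \<forall>u\<in>words s'. p @ u @ v @ q \<in> P)"
    using times.IH(1)[of p "_ @ q"] by simp
  also have "\<dots> = (\<forall>u\<in>words s'. \<forall>v\<in>words t'. p @ u @ v @ q \<in> P)" by blast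
  finally show ?case unfolding fst_conv snd_conv split .
qed simp_all

section \<open>Evaluation of words in the endomorphism semirings\<close>

text \<open>Letters act on the states 0, 1, 2 like an automaton reading from the left, in the
  composition order of \<open>end_mul\<close>.\<close>

definition run :: "(nat \<Rightarrow> nat \<Rightarrow> nat) \<Rightarrow> nat list \<Rightarrow> nat \<Rightarrow> nat" where
  "run \<rho> w x = fold \<rho> w x"

lemma run_simps [simp]:
  "run \<rho> [] x = x"
  "run \<rho> (i # w) x = run \<rho> w (\<rho> i x)"
  "run \<rho> (u @ w) x = run \<rho> w (run \<rho> u x)"
  by (simp_all add: run_def)

lemma A21_subset_EndC3: "A21 \<subseteq> EndC3"
  by (auto simp: A21_def)

lemma EndC3_le: "f \<in> EndC3 \<Longrightarrow> x \<le> 2 \<Longrightarrow> f x \<le> 2"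
  by (simp add: EndC3_def)

lemma EndC3_mono: "f \<in> EndC3 \<Longrightarrow> x \<le> y \<Longrightarrow> y \<le> 2 \<Longrightarrow> f x \<le> f y"
  by (simp add: EndC3_def)

lemma run_le: "\<forall>i. \<rho> i \<in> EndC3 \<Longrightarrow> x \<le> 2 \<Longrightarrow> run \<rho> w x \<le> 2"
  by (induction w arbitrary: x) (auto simp: EndC3_le)

lemma run_mono: "\<forall>i. \<rho> i \<in> EndC3 \<Longrightarrow> x \<le> y \<Longrightarrow> y \<le> 2 \<Longrightarrow> run \<rho> w x \<le> run \<rho> w y"
  by (induction w arbitrary: x y) (auto simp: EndC3_le EndC3_mono)

lemma end_add_apply: "end_add f g x = max (f x) (g x)"
  by (simp add: end_add_def)

lemma end_mul_apply: "x \<le> 2 \<Longrightarrow> end_mul f g x = g (f x)"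
  by (simp add: end_mul_def)

lemma end_add_in_EndC3: "f \<in> EndC3 \<Longrightarrow> g \<in> EndC3 \<Longrightarrow> end_add f g \<in> EndC3"
  by (auto simp: EndC3_def end_add_def intro: le_max_iff_disj[THEN iffD2])

lemma end_mul_in_EndC3: "f \<in> EndC3 \<Longrightarrow> g \<in> EndC3 \<Longrightarrow> end_mul f g \<in> EndC3"
  by (auto simp: EndC3_def end_mul_def)

lemma eval_in_EndC3:
  "\<forall>i. \<rho> i \<in> EndC3 \<Longrightarrow> eval end_add end_mul \<rho> t \<in> EndC3"
  by (induction t) (auto intro: end_add_in_EndC3 end_mul_in_EndC3)

lemma eval_in_A21:
  assumes "\<forall>i. \<rho> i \<in> A21"
  shows "eval end_add end_mul \<rho> t \<in> A21"
proof -
  have "eval end_add end_mul \<rho> t 2 = 2"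
    by (induction t) (use assms in \<open>auto simp: A21_def end_add_apply end_mul_apply\<close>)
  then show ?thesis
    using eval_in_EndC3[of \<rho> t] assms by (auto simp: A21_def)
qed

text \<open>With \<open>eval_eq_run\<close>: at each state a term takes the maximum of the runs of
  its words. Monotonicity of runs handles products.\<close>

lemma run_le_eval:
  assumes "\<forall>i. \<rho> i \<in> EndC3" "w \<in> words t" "x \<le> 2"
  shows "run \<rho> w x \<le> eval end_add end_mul \<rho> t x"
  using assms(2,3)
proof (induction t arbitrary: w x)
  case (Plus s t)
  then show ?case by (auto simp: end_add_apply le_max_iff_disj)
next
  case (Times s t)
  then obtain u v where uv: "w = u @ v" "u \<in> words s" "v \<in> words t" by auto
  have le: "eval end_add end_mul \<rho> s x \<le> 2"
    using EndC3_le eval_in_EndC3 assms(1) Times.prems(2) by blast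
  have "run \<rho> w x \<le> run \<rho> v (eval end_add end_mul \<rho> s x)"
    using run_mono[OF assms(1) Times.IH(1)[OF uv(2) Times.prems(2)] le] uv(1) by simp
  also have "\<dots> \<le> eval end_add end_mul \<rho> (Times s t) x"
    using Times.IH(2)[OF uv(3) le] Times.prems(2) by (simp add: end_mul_apply)
  finally show ?case .
qed simp

lemma eval_eq_run:
  assumes "\<forall>i. \<rho> i \<in> EndC3" "x \<le> 2"
  shows "\<exists>w\<in>words t. eval end_add end_mul \<rho> t x = run \<rho> w x"
  using assms(2)
proof (induction t arbitrary: x)
  case (Plus s t)
  then show ?case by (auto simp: end_add_apply max_def)
next
  case (Times s t)
  have "eval end_add end_mul \<rho> s x \<le> 2"
    using EndC3_le eval_in_EndC3 assms(1) Times.prems by blast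
  then obtain v where v: "v \<in> words t"
    "eval end_add end_mul \<rho> t (eval end_add end_mul \<rho> s x) = run \<rho> v (eval end_add end_mul \<rho> s x)"
    using Times.IH(2) by blast
  obtain u where "u \<in> words s" "eval end_add end_mul \<rho> s x = run \<rho> u x"
    using Times.IH(1) Times.prems by blast
  with v Times.prems show ?case
    by (intro bexI[of _ "u @ v"]) (auto simp: end_mul_apply)
qed simp

lemma eval_subst:
  "eval ad mu \<rho> (subst \<sigma> t) = eval ad mu (\<lambda>i. eval ad mu \<rho> (\<sigma> i)) t"
  by (induction t) auto

section \<open>The inequalities between words in A21\<close>

text \<open>The inequality between \<open>v\<close> and the sum of \<open>U\<close>;
  \<open>u\<close> may depend on the state since sums are pointwise maxima in a chain.\<close>

definition below_A21 :: "nat list \<Rightarrow> nat list set \<Rightarrow> bool" where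
  "below_A21 v U \<longleftrightarrow>
     (\<forall>\<rho> x. (\<forall>i. \<rho> i \<in> A21) \<longrightarrow> x \<le> 2 \<longrightarrow> (\<exists>u\<in>U. run \<rho> v x \<le> run \<rho> u x))"

text \<open>The hypothesis is applied at the state reached by \<open>p\<close>, and running
  \<open>q\<close> is monotone.\<close>

lemma below_A21_context:
  assumes "below_A21 v U"
  shows "below_A21 (p @ v @ q) ((\<lambda>u. p @ u @ q) ` U)"
  unfolding below_A21_def
proof (intro allI impI)
  fix \<rho> :: "nat \<Rightarrow> nat \<Rightarrow> nat" and x :: nat
  assume \<rho>: "\<forall>i. \<rho> i \<in> A21" and x: "x \<le> 2"
  then have E: "\<forall>i. \<rho> i \<in> EndC3" using A21_subset_EndC3 by blast
  have px: "run \<rho> p x \<le> 2" using run_le[OF E x] .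
  obtain u where u: "u \<in> U" "run \<rho> v (run \<rho> p x) \<le> run \<rho> u (run \<rho> p x)"
    using assms \<rho> px unfolding below_A21_def by blast
  then show "\<exists>u\<in>(\<lambda>u. p @ u @ q) ` U. run \<rho> (p @ v @ q) x \<le> run \<rho> u x"
    using run_mono[OF E u(2) run_le[OF E px]] by auto
qed

lemma below_A21_subst:
  assumes "holds_in A21 end_add end_mul (s, t)" "v \<in> words (subst \<sigma> t)"
  shows "below_A21 v (words (subst \<sigma> s))"
  unfolding below_A21_def
proof (intro allI impI)
  fix \<rho> :: "nat \<Rightarrow> nat \<Rightarrow> nat" and x :: nat
  assume \<rho>: "\<forall>i. \<rho> i \<in> A21" and x: "x \<le> 2"
  then have E: "\<forall>i. \<rho> i \<in> EndC3" using A21_subset_EndC3 by blast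
  have "eval end_add end_mul \<rho> (subst \<sigma> s) = eval end_add end_mul \<rho> (subst \<sigma> t)"
    using assms(1) eval_in_A21[of \<rho>] \<rho> by (simp add: holds_in_def eval_subst)
  then show "\<exists>u\<in>words (subst \<sigma> s). run \<rho> v x \<le> run \<rho> u x"
    using eval_eq_run[OF E x, of "subst \<sigma> s"] run_le_eval[OF E assms(2) x] by auto
qed

definition map3 :: "nat \<Rightarrow> nat \<Rightarrow> nat \<Rightarrow> nat" where
  "map3 a b x = (if x = 0 then a else if x = 1 then b else if x = 2 then 2 else 0)"

lemma map3_simps [simp]:
  "map3 a b 0 = a" "map3 a b 1 = b" "map3 a b (Suc 0) = b" "map3 a b 2 = 2"
  by (auto simp: map3_def)

lemma map3_in_A21: "a \<le> b \<Longrightarrow> b \<le> 2 \<Longrightarrow> map3 a b \<in> A21"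
  by (auto simp: map3_def A21_def EndC3_def)

lemma le2_cases: "(n::nat) \<le> 2 \<Longrightarrow> n = 0 \<or> n = 1 \<or> n = 2"
  by auto

text \<open>State 2 is absorbing in A21. In the next three lemmas the letters of \<open>q\<close> (of \<open>v\<close> in the
  third) act as the identity, \<open>x\<close> moves state 0 to 1, \<open>y\<close> moves state 1 to 2, and every other letter resets
  1 to 0.\<close>

lemma below_A21_factor:
  assumes "below_A21 (l @ x # q @ y # r) U"
  shows "\<exists>u\<in>U. \<exists>l' p r'. u = l' @ x # p @ y # r' \<and> set p \<subseteq> insert x (insert y (set q))"
proof -
  define A where "A = insert x (insert y (set q))"
  \<comment> \<open>If \<open>x = y\<close>, a single letter has to perform both moves.\<close>
  define \<rho> where "\<rho> z = (if z = x then (if x = y then map3 1 2 else map3 1 1)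
    else if z = y then map3 0 2 else if z \<in> set q then map3 0 1 else map3 0 0)" for z
  have \<rho>A: "\<rho> i \<in> A21" for i by (auto simp: \<rho>_def intro: map3_in_A21)
  then have E: "\<forall>i. \<rho> i \<in> EndC3" using A21_subset_EndC3 by blast
  have two: "\<rho> i 2 = 2" for i by (simp add: \<rho>_def)
  have absorb: "run \<rho> w 2 = 2" for w by (induction w) (auto simp: two)
  have keep: "1 \<le> run \<rho> w s" if "set w \<subseteq> A" "1 \<le> s" "s \<le> 2" for w s
    using that
  proof (induction w arbitrary: s)
    case (Cons z w)
    then have "s = 1 \<or> s = 2" by auto
    then have "1 \<le> \<rho> z s" using Cons.prems by (auto simp: \<rho>_def A_def)
    then show ?case using Cons EndC3_le[OF spec[OF E]] by simp
  qed simp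
  have "run \<rho> (l @ x # q @ y # r) 0 = 2"
  proof -
    \<comment> \<open>Whatever state \<open>l\<close> leads to, \<open>x\<close> lifts it to at
      least 1, \<open>q\<close> keeps it there and \<open>y\<close> completes the move to 2.\<close>
    define s where "s = run \<rho> l 0"
    have "s \<le> 2" using run_le[OF E] by (simp add: s_def)
    then have "1 \<le> \<rho> x s" "\<rho> x s \<le> 2" using le2_cases[of s] by (auto simp: \<rho>_def)
    then have "1 \<le> run \<rho> q (\<rho> x s)" "run \<rho> q (\<rho> x s) \<le> 2"
      using keep[of q] run_le[OF E] by (auto simp: A_def)
    then have "\<rho> y (run \<rho> q (\<rho> x s)) = 2"
      using le2_cases[of "run \<rho> q (\<rho> x s)"] by (auto simp: \<rho>_def)
    then show ?thesis by (simp add: s_def absorb)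
  qed
  moreover have "run \<rho> u 0 \<le> 2" for u using run_le[OF E] by simp
  ultimately obtain u where u: "u \<in> U" "run \<rho> u 0 = 2"
    using assms \<rho>A unfolding below_A21_def by (metis le_antisym zero_le)
  \<comment> \<open>State 1 records an \<open>x\<close> followed so far by letters of
    \<open>A\<close> only, state 2 a completed factor.\<close>
  have "(run \<rho> u 0 = 1 \<longrightarrow> (\<exists>l p. u = l @ x # p \<and> set p \<subseteq> A)) \<and>
        (run \<rho> u 0 = 2 \<longrightarrow> (\<exists>l p r. u = l @ x # p @ y # r \<and> set p \<subseteq> A))"
  proof (induction u rule: rev_induct)
    case (snoc z u)
    have "run \<rho> u 0 \<le> 2" using run_le[OF E] by simp
    then consider "run \<rho> u 0 = 0" | "run \<rho> u 0 = 1" | "run \<rho> u 0 = 2" by linarith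
    then show ?case
    proof cases
      case 1
      then have "run \<rho> (u @ [z]) 0 = (if z = x then 1 else 0)" by (auto simp: \<rho>_def)
      moreover have "\<exists>l p. u @ [x] = l @ x # p \<and> set p \<subseteq> A"
        by (intro exI[of _ u] exI[of _ "[]"]) simp
      ultimately show ?thesis by (auto split: if_splits)
    next
      case 2
      then obtain l p where lp: "u = l @ x # p" "set p \<subseteq> A" using snoc by auto
      have "run \<rho> (u @ [z]) 0 = (if z = y then 2 else if z \<in> A then 1 else 0)"
        using 2 by (auto simp: \<rho>_def A_def)
      moreover have "\<exists>l p r. u @ [y] = l @ x # p @ y # r \<and> set p \<subseteq> A"
        using lp by (intro exI[of _ l] exI[of _ p] exI[of _ "[]"]) simp
      moreover have "\<exists>l p. u @ [z] = l @ x # p \<and> set p \<subseteq> A" if "z \<in> A"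
        using lp that by (intro exI[of _ l] exI[of _ "p @ [z]"]) simp
      ultimately show ?thesis by (auto split: if_splits)
    next
      case 3
      then obtain l p r where lp: "u = l @ x # p @ y # r" "set p \<subseteq> A" using snoc by auto
      then have "\<exists>l p r. u @ [z] = l @ x # p @ y # r \<and> set p \<subseteq> A"
        by (intro exI[of _ l] exI[of _ p] exI[of _ "r @ [z]"]) simp
      then show ?thesis using 3 by (simp add: two)
    qed
  qed simp
  then show ?thesis using u unfolding A_def by blast
qed

lemma below_A21_prefix:
  assumes "below_A21 (q @ y # r) U"
  shows "\<exists>u\<in>U. \<exists>p r'. u = p @ y # r' \<and> set p \<subseteq> insert y (set q)"
proof -
  define A where "A = insert y (set q)"
  define \<rho> where "\<rho> z = (if z = y then map3 0 2 else if z \<in> set q then map3 0 1 else map3 0 0)" for z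
  have \<rho>A: "\<rho> i \<in> A21" for i by (auto simp: \<rho>_def intro: map3_in_A21)
  then have E: "\<forall>i. \<rho> i \<in> EndC3" using A21_subset_EndC3 by blast
  \<comment> \<open>Now 0 is absorbing as well: a run from 1 is lost once a letter outside
    \<open>A\<close> precedes the first \<open>y\<close>.\<close>
  have two: "\<rho> i 2 = 2" and zero: "\<rho> i 0 = 0" for i by (simp_all add: \<rho>_def)
  have absorb: "run \<rho> w 2 = 2" "run \<rho> w 0 = 0" for w by (induction w) (auto simp: two zero)
  have keep: "1 \<le> run \<rho> w s" if "set w \<subseteq> A" "1 \<le> s" "s \<le> 2" for w s
    using that
  proof (induction w arbitrary: s)
    case (Cons z w)
    then have "s = 1 \<or> s = 2" by auto
    then have "1 \<le> \<rho> z s" using Cons.prems by (auto simp: \<rho>_def A_def)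
    then show ?case using Cons EndC3_le[OF spec[OF E]] by simp
  qed simp
  have "1 \<le> run \<rho> q 1" "run \<rho> q 1 \<le> 2" using keep[of q 1] run_le[OF E, of 1 q] by (auto simp: A_def)
  then have "\<rho> y (run \<rho> q 1) = 2" using le2_cases[of "run \<rho> q 1"] by (auto simp: \<rho>_def)
  then have "run \<rho> (q @ y # r) 1 = 2" by (simp add: absorb)
  moreover have "run \<rho> u 1 \<le> 2" for u using run_le[OF E] by simp
  ultimately obtain u where u: "u \<in> U" "run \<rho> u 1 = 2"
    using assms \<rho>A unfolding below_A21_def by (metis le_antisym one_le_numeral)
  have "\<exists>p r'. u = p @ y # r' \<and> set p \<subseteq> A"
    using u(2)
  proof (induction u)
    case (Cons z u)
    consider "z = y" | "z \<noteq> y" "z \<in> set q" | "z \<noteq> y" "z \<notin> set q" by blast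
    then show ?case
    proof cases
      case 1
      then show ?thesis by (intro exI[of _ "[]"] exI[of _ u]) simp
    next
      case 2
      then obtain p r' where "u = p @ y # r'" "set p \<subseteq> A" using Cons by (auto simp: \<rho>_def)
      then show ?thesis using 2 by (intro exI[of _ "z # p"] exI[of _ r']) (simp add: A_def)
    next
      case 3
      then have "\<rho> z 1 = 0" by (simp add: \<rho>_def)
      then show ?thesis using Cons.prems absorb(2)[of u] by simp
    qed
  qed simp
  then show ?thesis using u(1) unfolding A_def by blast
qed

lemma below_A21_content:
  assumes "below_A21 v U"
  shows "\<exists>u\<in>U. set u \<subseteq> set v"
proof -
  define \<rho> where "\<rho> z = (if z \<in> set v then map3 0 1 else map3 0 0)" for z
  have \<rho>A: "\<rho> i \<in> A21" for i by (auto simp: \<rho>_def intro: map3_in_A21)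
  have "\<rho> i 0 = 0" for i by (simp add: \<rho>_def)
  then have zero: "run \<rho> w 0 = 0" for w by (induction w) auto
  have run1: "run \<rho> w 1 = (if set w \<subseteq> set v then 1 else 0)" for w
  proof (induction w)
    case (Cons z w)
    have "\<rho> z 1 = (if z \<in> set v then 1 else 0)" by (simp add: \<rho>_def)
    then show ?case using Cons zero[of w] by simp
  qed simp
  obtain u where "u \<in> U" "run \<rho> v 1 \<le> run \<rho> u 1"
    using assms \<rho>A unfolding below_A21_def by (metis one_le_numeral)
  then show ?thesis using run1 by (auto split: if_splits)
qed

section \<open>The critical words\<close>

text \<open>At least \<open>m\<close>, hence distinct from the letters of \<open>[0..<m]\<close>;
  for \<open>j < m\<close> division by \<open>m\<close> recovers \<open>i\<close> and
  \<open>j\<close>.\<close>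

definition marker :: "nat \<Rightarrow> nat \<Rightarrow> nat \<Rightarrow> nat" where
  "marker m i j = Suc i * m + j"

text \<open>\<open>remdups\<close> drops the repeated letter when \<open>i = m - 1\<close> or \<open>j = 0\<close>, as \<open>descents_full\<close> forbids
  squares of letters.\<close>

definition marked_word :: "nat \<Rightarrow> nat \<Rightarrow> nat \<Rightarrow> nat list" where
  "marked_word m i j = marker m i j # remdups [i, m - 1] @ remdups [0, j]"

definition critical_words :: "nat \<Rightarrow> nat list set" where
  "critical_words m = insert [0..<m] {marked_word m i j | i j. j \<le> i \<and> i < m}"

text \<open>Descents need not be adjacent, and repeated letters count. Bounding the letters between
  \<open>x\<close> and \<open>y\<close> from below is what \<open>below_A21_factor\<close> can
  transfer to smaller words.\<close>

definition descents_full :: "nat \<Rightarrow> nat list \<Rightarrow> bool" where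
  "descents_full m v \<longleftrightarrow>
     (\<forall>l x q y r. v = l @ x # q @ y # r \<longrightarrow> y \<le> x \<longrightarrow> {0, m - 1} \<subseteq> insert x (insert y (set q)))"

text \<open>The letters of \<open>marked_word m i j\<close>, recovered from \<open>a = marker m i j\<close>.\<close>

definition marked_letters :: "nat \<Rightarrow> nat \<Rightarrow> nat set" where
  "marked_letters m a = {0, m - 1, a div m - 1, a mod m}"

text \<open>Contains the critical words and is closed under taking words below few of its members.\<close>

definition stable_words :: "nat \<Rightarrow> nat list set" where
  "stable_words m = insert [0..<m]
     {a # v | a v. m \<le> a \<and> set v \<subseteq> marked_letters m a \<inter> {..<m} \<and> descents_full m v}"

lemma finite_critical_words: "finite (critical_words m)"
proof -
  have "critical_words m \<subseteq> insert [0..<m] ((\<lambda>(i, j). marked_word m i j) ` ({..<m} \<times> {..<m}))"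
    by (auto simp: critical_words_def)
  then show ?thesis by (rule finite_subset) simp
qed

text \<open>After the marker come two strictly increasing blocks, one ending in \<open>m - 1\<close>
  and one starting with 0. A descent goes from the first block to the second and so contains both
  letters.\<close>

lemma critical_words_stable:
  assumes "2 \<le> m"
  shows "critical_words m \<subseteq> stable_words m"
proof -
  have "marked_word m i j \<in> stable_words m" if "j \<le> i" "i < m" for i j
  proof -
    have "marker m i j div m = Suc i" "marker m i j mod m = j" "m \<le> marker m i j"
      using that div_mult_self3[of m "Suc i" j] mod_mult_self3[of "Suc i" m j]
      by (auto simp: marker_def simp del: mult_Suc) simp
    moreover have "descents_full m (remdups [i, m - 1] @ remdups [0, j])"
      using that assms
      by (auto simp: descents_full_def append_eq_Cons_conv Cons_eq_append_conv split: if_splits)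
    ultimately show ?thesis
      using that by (auto simp: stable_words_def marked_word_def marked_letters_def)
  qed
  then show ?thesis by (auto simp: critical_words_def stable_words_def)
qed

text \<open>Such a pair cannot occur in the strictly increasing word \<open>[0..<m]\<close>, so
  \<open>u\<close> carries a marker, at its front only.\<close>

lemma stable_wordsD:
  assumes "u \<in> stable_words m" "u = l @ x # p @ y # r" "y \<le> x \<or> m \<le> x"
  shows "y \<in> marked_letters m (hd u)" "y < m" "l = [] \<longleftrightarrow> m \<le> x"
    "l \<noteq> [] \<Longrightarrow> x \<in> marked_letters m (hd u)"
    "l \<noteq> [] \<Longrightarrow> {0, m - 1} \<subseteq> insert x (insert y (set p))"
proof -
  have "u \<noteq> [0..<m]"
  proof
    assume "u = [0..<m]"
    then have "sorted_wrt (<) (l @ x # p @ y # r)" "x \<in> set [0..<m]"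
      using assms(2) by (metis sorted_wrt_upt) (use \<open>u = [0..<m]\<close> assms(2) in \<open>metis in_set_conv_decomp\<close>)
    then show False using assms(3) by (auto simp: sorted_wrt_append)
  qed
  then obtain a v where av: "u = a # v" "m \<le> a" "set v \<subseteq> marked_letters m a \<inter> {..<m}"
    "descents_full m v"
    using assms(1) by (auto simp: stable_words_def)
  show "y \<in> marked_letters m (hd u)" "y < m" "l = [] \<longleftrightarrow> m \<le> x"
    "l \<noteq> [] \<Longrightarrow> x \<in> marked_letters m (hd u)"
    using av assms(2) by (cases l; auto)+
  assume "l \<noteq> []"
  then obtain l' where v: "v = l' @ x # p @ y # r" using av assms(2) by (cases l) auto
  then have "x < m" using av(3) by auto
  then show "{0, m - 1} \<subseteq> insert x (insert y (set p))"
    using av(4) v assms(3) unfolding descents_full_def by fastforce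
qed

lemma stable_words_tail:
  assumes "u \<in> stable_words m" "u = l @ y # r" "l \<noteq> []"
  shows "y < m"
proof (cases "u = [0..<m]")
  case True
  then have "y \<in> set [0..<m]" using assms(2) by (metis in_set_conv_decomp)
  then show ?thesis by simp
next
  case False
  then show ?thesis using assms by (cases l) (auto simp: stable_words_def)
qed

text \<open>A descent in an unmarked word forces every letter to precede a second occurrence of 0,
  and a marked word accounts for at most four of these letters.\<close>

lemma below_stable_words:
  assumes "2 \<le> m" "U \<subseteq> stable_words m" "finite U" "4 * card U < m" "below_A21 v U"
  shows "v \<in> stable_words m"
proof (cases "\<exists>a\<in>set v. m \<le> a")
  case True
  then obtain a l r where a: "m \<le> a" and v: "v = l @ a # r" by (metis in_set_conv_decomp)
  \<comment> \<open>A letter directly before \<open>a\<close> would make \<open>a\<close> a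
    non-initial letter of some word in \<open>U\<close>, but markers are initial.\<close>
  have "l = []"
  proof (rule ccontr)
    assume "l \<noteq> []"
    then obtain l' x where "l = l' @ [x]" by (metis rev_exhaust)
    then have "below_A21 (l' @ x # [] @ a # r) U" using assms(5) v by simp
    from below_A21_factor[OF this] obtain u l'' p r'
      where u: "u \<in> U" "u = l'' @ x # p @ a # r'" by blast
    then have "a < m"
      using assms(2) stable_words_tail[of u m "l'' @ x # p" a r'] by auto
    with a show False by simp
  qed
  have "y \<in> marked_letters m a \<inter> {..<m}" if "y \<in> set r" for y
  proof -
    obtain q r' where "r = q @ y # r'" using \<open>y \<in> set r\<close> by (metis in_set_conv_decomp)
    then have "below_A21 ([] @ a # q @ y # r') U" using assms(5) v \<open>l = []\<close> by simp
    from below_A21_factor[OF this] obtain u l'' p r''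
      where u: "u \<in> U" "u = l'' @ a # p @ y # r''" by blast
    then have st: "u \<in> stable_words m" using assms(2) by blast
    have "l'' = []" using stable_wordsD(3)[OF st u(2)] a by simp
    then show ?thesis using stable_wordsD(1,2)[OF st u(2)] a u(2) by simp
  qed
  moreover have "descents_full m r"
    unfolding descents_full_def
  proof (intro allI impI)
    fix l1 x q y r1
    assume r: "r = l1 @ x # q @ y # r1" and "y \<le> x"
    then have "x < m" using calculation by auto
    have "below_A21 ((a # l1) @ x # q @ y # r1) U" using assms(5) v \<open>l = []\<close> r by simp
    from below_A21_factor[OF this] obtain u l'' p r''
      where u: "u \<in> U" "u = l'' @ x # p @ y # r''" "set p \<subseteq> insert x (insert y (set q))" by blast
    then have st: "u \<in> stable_words m" using assms(2) by blast
    have "l'' \<noteq> []" using stable_wordsD(3)[OF st u(2)] \<open>y \<le> x\<close> \<open>x < m\<close> by simp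
    then have "{0, m - 1} \<subseteq> insert x (insert y (set p))"
      using stable_wordsD(5)[OF st u(2)] \<open>y \<le> x\<close> by blast
    with u(3) show "{0, m - 1} \<subseteq> insert x (insert y (set q))" by blast
  qed
  ultimately show ?thesis using a v \<open>l = []\<close> by (auto simp: stable_words_def)
next
  case False
  then have small: "x < m" if "x \<in> set v" for x using that by auto
  have plain: "u = [0..<m]" if u: "u \<in> U" "\<And>z. z \<in> set (take 1 u) \<Longrightarrow> z < m" for u
  proof (rule ccontr)
    assume "u \<noteq> [0..<m]"
    then obtain a w where "u = a # w" "m \<le> a"
      using subsetD[OF assms(2) u(1)] by (auto simp: stable_words_def)
    then show False using u(2)[of a] by simp
  qed
  have full: "{..<m} \<subseteq> set v"
  proof -
    obtain u where u: "u \<in> U" "set u \<subseteq> set v" using below_A21_content[OF assms(5)] by blast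
    then have "u = [0..<m]" using plain small by (meson in_set_takeD subsetD)
    then show ?thesis using u(2) by auto
  qed
  \<comment> \<open>\<open>below_A21_prefix\<close> supplies a word of \<open>U\<close> whose first
    letter occurs in \<open>v\<close>, hence \<open>[0..<m]\<close>, where \<open>y\<close> is
    preceded by all smaller letters.\<close>
  have first: "{..<y} \<subseteq> set q" if "v = q @ y # r" for q y r
  proof -
    obtain u p r' where u: "u \<in> U" "u = p @ y # r'" "set p \<subseteq> insert y (set q)"
      using below_A21_prefix assms(5) \<open>v = q @ y # r\<close> by metis
    have "set (take 1 u) \<subseteq> insert y (set q)" using u(2,3) by (cases p) auto
    moreover have "insert y (set q) \<subseteq> set v" using that by auto
    ultimately have eq: "u = [0..<m]" using plain[OF u(1)] small by blast
    have len: "length p < m" using arg_cong[OF u(2), of length] eq by simp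
    have "y = [0..<m] ! length p" using eq u(2) by (metis nth_append_length)
    then have y: "y = length p" using len by simp
    have "p = take (length p) [0..<m]" using eq u(2) by (metis append_eq_conv_conj)
    then have "p = [0..<y]" using len y by (simp add: take_upt)
    then have "set p = {..<y}" by auto
    then show ?thesis using u(3) by auto
  qed
  show ?thesis
  proof (cases "sorted_wrt (<) v")
    case True
    then have "sorted v" "distinct v" by (auto simp: strict_sorted_iff)
    moreover have "set v = set [0..<m]" using full small by auto
    ultimately have "v = [0..<m]" by (metis distinct_upt sorted_distinct_set_unique sorted_upt)
    then show ?thesis by (simp add: stable_words_def)
  next
    case False
    have "\<exists>l x y r. v = l @ x # y # r \<and> y \<le> x"
    proof -
      obtain i where i: "Suc i < length v" "v ! Suc i \<le> v ! i"
        using False by (metis leI sorted_wrt_iff_nth_Suc_transp transp_on_less)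
      have "v = take i v @ v ! i # v ! Suc i # drop (Suc (Suc i)) v"
        using i(1) by (simp add: Cons_nth_drop_Suc)
      with i(2) show ?thesis by blast
    qed
    then obtain l x y r where v: "v = l @ x # y # r" and "y \<le> x" by blast
    have "x < m" using small v by simp
    have "below_A21 (l @ x # [] @ y # r) U" using assms(5) v by simp
    from below_A21_factor[OF this] obtain u l' p r'
      where u: "u \<in> U" "u = l' @ x # p @ y # r'" "set p \<subseteq> {x, y}" by auto
    have st: "u \<in> stable_words m" using u(1) assms(2) by blast
    have "l' \<noteq> []" using stable_wordsD(3)[OF st u(2)] \<open>y \<le> x\<close> \<open>x < m\<close> by simp
    \<comment> \<open>The descent is adjacent, so no letter between can help to provide 0 and
      \<open>m - 1\<close>.\<close>
    then have "{0, m - 1} \<subseteq> {x, y}"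
      using stable_wordsD(5)[OF st u(2)] \<open>y \<le> x\<close> u(3) by blast
    then have xy: "x = m - 1" "y = 0" using \<open>y \<le> x\<close> assms(1) by auto
    \<comment> \<open>Each \<open>k < m\<close> is \<open>x = m - 1\<close> itself or lies in
      \<open>l\<close> by \<open>first\<close>. As \<open>k\<close> and the later 0 form a descent,
      some word of \<open>U\<close> has \<open>k\<close> among its marked letters.\<close>
    have "{..<m} \<subseteq> (\<Union>u\<in>U. marked_letters m (hd u))"
    proof
      fix k assume "k \<in> {..<m}"
      then have "k = x \<or> k < x" using xy by auto
      then have "k \<in> set (l @ [x])" using first[OF v] by auto
      then obtain l1 l2 where "l @ [x] = l1 @ k # l2" by (metis in_set_conv_decomp)
      then have "v = l1 @ k # l2 @ 0 # r" using v xy by (metis append.assoc append_Cons append_Nil)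
      then obtain u l' p r' where u: "u \<in> U" "u = l' @ k # p @ 0 # r'"
        using below_A21_factor assms(5) by metis
      have st: "u \<in> stable_words m" using u(1) assms(2) by blast
      have "l' \<noteq> []" using stable_wordsD(3)[OF st u(2)] \<open>k \<in> {..<m}\<close> by simp
      then show "k \<in> (\<Union>u\<in>U. marked_letters m (hd u))"
        using stable_wordsD(4)[OF st u(2)] u(1) by auto
    qed
    then have "m \<le> card (\<Union>u\<in>U. marked_letters m (hd u))"
      using card_mono[of "\<Union>u\<in>U. marked_letters m (hd u)" "{..<m}"] assms(3)
      by (simp add: marked_letters_def)
    also have "\<dots> \<le> (\<Sum>u\<in>U. card (marked_letters m (hd u)))"
      using assms(3) by (rule card_UN_le)
    also have "\<dots> \<le> (\<Sum>u\<in>U. 4)"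
      by (rule sum_mono) (auto simp: marked_letters_def card_insert_if)
    finally show ?thesis using assms(4) by simp
  qed
qed

section \<open>The square of \<open>[0..<m]\<close>: not stable, yet below the critical
  words\<close>

lemma square_not_stable: "2 \<le> m \<Longrightarrow> [0..<m] @ [0..<m] \<notin> stable_words m"
proof
  assume m: "2 \<le> m" and "[0..<m] @ [0..<m] \<in> stable_words m"
  moreover have "[0..<m] = 0 # [1..<m]" using m by (simp add: upt_conv_Cons)
  ultimately show False by (auto simp: stable_words_def)
qed

text \<open>If the square beats \<open>[0..<m]\<close> at some state, then \<open>[0..<m]\<close> maps 0 to 1 and 1 to 2. Its runs
  from 0 and from 1 never meet, so the last letter \<open>i\<close> lifting the former to 1 comes no earlier
  than the first letter \<open>j\<close> lifting the latter to 2.\<close>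

lemma square_below_critical:
  assumes \<rho>: "\<forall>i. \<rho> i \<in> EndC3" and s: "s \<le> 2" and m: "2 \<le> m"
  shows "\<exists>u\<in>critical_words m. run \<rho> ([0..<m] @ [0..<m]) s \<le> run \<rho> u s"
proof (cases "run \<rho> ([0..<m] @ [0..<m]) s \<le> run \<rho> [0..<m] s")
  case True
  then show ?thesis by (auto simp: critical_words_def)
next
  case False
  define g where "g = run \<rho> [0..<m]"
  have g_le: "g x \<le> 2" if "x \<le> 2" for x using run_le[OF \<rho> that] by (simp add: g_def)
  have g_mono: "g x \<le> g y" if "x \<le> y" "y \<le> 2" for x y
    using run_mono[OF \<rho> that] by (simp add: g_def)
  have less: "g s < g (g s)" using False by (simp add: g_def)
  \<comment> \<open>Otherwise monotonicity would give \<open>g (g s) \<le> g s\<close>. Three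
    strictly increasing states can only be 0, 1, 2.\<close>
  moreover have "s < g s"
    using g_mono[of "g s" s] s less by linarith
  moreover have "g (g s) \<le> 2" using g_le s by simp
  ultimately have "s = 0" "g s = 1" "g (g s) = 2" by linarith+
  then have g0: "g 0 = 1" and g1: "g 1 = 2" by auto
  \<comment> \<open>\<open>p t\<close> and \<open>r t\<close> are the states after \<open>t\<close>
    letters, started at 0 and at 1. If they met or crossed, monotonicity would give
    \<open>g 1 \<le> g 0\<close>.\<close>
  define p where "p t = run \<rho> [0..<t] 0" for t
  define r where "r t = run \<rho> [0..<t] 1" for t
  have step: "p (Suc t) = \<rho> t (p t)" "r (Suc t) = \<rho> t (r t)" for t
    by (simp_all add: p_def r_def)
  have pr: "p t < r t" "r t \<le> 2" if "t \<le> m" for t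
  proof -
    have split: "g x = run \<rho> [t..<m] (run \<rho> [0..<t] x)" for x
      using upt_add_eq_append[of 0 t "m - t"] that by (simp add: g_def)
    show "r t \<le> 2" using run_le[OF \<rho>] by (simp add: r_def)
    show "p t < r t"
    proof (rule ccontr)
      assume "\<not> p t < r t"
      then have "g 1 \<le> g 0"
        using run_mono[OF \<rho>, of "r t" "p t" "[t..<m]"] run_le[OF \<rho>, of 0 "[0..<t]"]
        unfolding split p_def r_def by simp
      then show False using g0 g1 by simp
    qed
  qed
  have ends: "p 0 = 0" "r 0 = 1" "p m = 1" "r m = 2"
    using g0 g1 by (simp_all add: p_def r_def g_def)
  define i where "i = (GREATEST t. t \<le> m \<and> p t = 0)"
  have i: "i \<le> m \<and> p i = 0"
    unfolding i_def by (rule GreatestI_nat[where b = m and k = 0]) (use ends in auto)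
  have i_max: "t \<le> i" if "t \<le> m" "p t = 0" for t
    unfolding i_def by (rule Greatest_le_nat[where b = m]) (use that in auto)
  define j where "j = (LEAST t. r (Suc t) = 2)"
  have "r (Suc (m - 1)) = 2" using ends m by simp
  then have j: "r (Suc j) = 2" "j \<le> m - 1"
    unfolding j_def by (rule LeastI, rule Least_le)
  have im: "i < m" using i ends by (metis le_neq_implies_less zero_neq_one)
  have p1: "p t = 1" if "i < t" "t \<le> m" for t
    using i_max[of t] pr[of t] that by linarith
  have r1: "r t = 1" if "t \<le> j" for t
  proof (cases t)
    case (Suc t')
    then have "r t \<noteq> 2" using not_less_Least[of t' "\<lambda>t. r (Suc t) = 2"] that by (simp add: j_def)
    then show ?thesis using pr[of t] that j(2) m by linarith
  qed (use ends in simp)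
  \<comment> \<open>If \<open>i < j\<close>, both runs would be in state 1 after \<open>j\<close>
    letters.\<close>
  have ji: "j \<le> i"
  proof (rule ccontr)
    assume "\<not> j \<le> i"
    moreover have "j \<le> m" using j(2) by simp
    ultimately show False using p1[of j] r1[of j] pr(1)[of j] by simp
  qed
  have \<rho>i: "\<rho> i 0 = 1" using step(1)[of i] i p1[of "Suc i"] im by simp
  have \<rho>j: "\<rho> j 1 = 2" using step(2)[of j] j r1[of j] by simp
  \<comment> \<open>The run from 0 is already at 1 before its last letter, and the run from 1 is
    still at 1 after its first. Thus both letters fix 1 and the marked word passes through 0, 1, 1,
    1, 2, with steps dropped where letters coincide.\<close>
  have \<rho>m: "\<rho> (m - 1) 1 = 1" if "i \<noteq> m - 1"
    using step(1)[of "m - 1"] p1[of "m - 1"] ends that im m by simp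
  have \<rho>0: "\<rho> 0 1 = 1" if "j \<noteq> 0"
    using step(2)[of 0] r1[of "Suc 0"] ends that by simp
  have two: "run \<rho> (remdups [i, m - 1] @ remdups [0, j]) 0 = 2"
    using \<rho>i \<rho>j \<rho>m \<rho>0 by (auto simp: eq_commute[of _ i] eq_commute[of _ j])
  \<comment> \<open>The marker may act arbitrarily: its image is at least 0, and by monotonicity the
    run still ends in 2.\<close>
  have "\<rho> (marker m i j) s \<le> 2" using \<rho> s EndC3_le by blast
  then have "2 \<le> run \<rho> (marked_word m i j) s"
    using run_mono[OF \<rho>, of 0 "\<rho> (marker m i j) s" "remdups [i, m - 1] @ remdups [0, j]"] two
    unfolding marked_word_def by (simp only: run_simps zero_le)
  moreover have "marked_word m i j \<in> critical_words m"
    using ji im by (auto simp: critical_words_def)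
  moreover have "run \<rho> ([0..<m] @ [0..<m]) s \<le> 2" using run_le[OF \<rho> s] .
  ultimately show ?thesis using le_trans by blast
qed

section \<open>No finite basis\<close>

lemma holds_in_A21_if_EndC3:
  "holds_in EndC3 end_add end_mul e \<Longrightarrow> holds_in A21 end_add end_mul e"
  unfolding holds_in_def using subsetD[OF A21_subset_EndC3] by simp

text \<open>The identity expresses that \<open>t\<close> lies below \<open>s\<close>.\<close>

lemma critical_identity_holds:
  assumes "2 \<le> m" "words s = critical_words m" "words t = {[0..<m] @ [0..<m]}"
  shows "holds_in EndC3 end_add end_mul (s, Plus s t)"
  unfolding holds_in_def
proof (intro allI impI ext)
  fix \<rho> :: "nat \<Rightarrow> nat \<Rightarrow> nat" and x :: nat
  assume \<rho>: "\<forall>i. \<rho> i \<in> EndC3"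
  show "eval end_add end_mul \<rho> (fst (s, Plus s t)) x = eval end_add end_mul \<rho> (snd (s, Plus s t)) x"
  proof (cases "x \<le> 2")
    case True
    have "eval end_add end_mul \<rho> t x = run \<rho> ([0..<m] @ [0..<m]) x"
      using eval_eq_run[OF \<rho> True, of t] assms(3) by auto
    moreover obtain u where "u \<in> words s" "run \<rho> ([0..<m] @ [0..<m]) x \<le> run \<rho> u x"
      using square_below_critical[OF \<rho> True assms(1)] assms(2) by blast
    ultimately have "eval end_add end_mul \<rho> t x \<le> eval end_add end_mul \<rho> s x"
      using run_le_eval[OF \<rho> _ True] by fastforce
    then show ?thesis by (simp add: end_add_apply)
  next
    case False
    then show ?thesis
      using eval_in_EndC3[OF \<rho>] by (auto simp: EndC3_def simp del: eval.simps)
  qed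
qed

text \<open>Validity in the larger semiring and underivability from identities of the smaller one
  settle both semirings at once.\<close>

lemma critical_identity_not_derivable:
  assumes "finite \<Sigma>" "\<forall>e\<in>\<Sigma>. holds_in A21 end_add end_mul e"
  shows "\<exists>e. holds_in EndC3 end_add end_mul e \<and> \<not> derivable \<Sigma> e"
proof -
  define B where "B s t = words_bound (leaves t) s" for s t
  \<comment> \<open>Every axiom can be used in both directions, so \<open>N\<close> dominates both
    bounds.\<close>
  define N where "N = (\<Sum>(s, t)\<in>\<Sigma>. B s t + B t s)"
  have N: "B s t \<le> N" "B t s \<le> N" if "(s, t) \<in> \<Sigma>" for s t
    using member_le_sum[OF that, of "\<lambda>(s, t). B s t + B t s"] assms(1) by (auto simp: N_def)
  define m where "m = 4 * N + 2"
  \<comment> \<open>After shrinking the substitution to what \<open>v\<close> needs, at most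
    \<open>N\<close> words of the other side remain, few enough for
    \<open>below_stable_words\<close>.\<close>
  have step: "p @ v @ q \<in> stable_words m"
    if id: "holds_in A21 end_add end_mul (s, t)" and "B s t \<le> N"
      and s: "\<forall>w\<in>words (subst \<sigma> s). p @ w @ q \<in> stable_words m" and v: "v \<in> words (subst \<sigma> t)"
    for s t \<sigma> p q v
  proof -
    obtain \<tau> where \<tau>: "\<forall>i. words (\<tau> i) \<subseteq> words (\<sigma> i) \<and> card (words (\<tau> i)) \<le> leaves t"
      "v \<in> words (subst \<tau> t)"
      using words_subst_local[OF v] by blast
    define U where "U = (\<lambda>u. p @ u @ q) ` words (subst \<tau> s)"
    have "card U \<le> card (words (subst \<tau> s))"
      unfolding U_def by (rule card_image_le[OF finite_words])
    also have "\<dots> \<le> N"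
      using card_words_subst_le[of \<tau> "leaves t" s] \<tau>(1) \<open>B s t \<le> N\<close> by (auto simp: B_def)
    finally have "4 * card U < m" by (simp add: m_def)
    moreover have "U \<subseteq> stable_words m"
      using s words_subst_mono[of \<tau> \<sigma> s] \<tau>(1) by (auto simp: U_def)
    moreover have "below_A21 (p @ v @ q) U"
      unfolding U_def by (rule below_A21_context[OF below_A21_subst[OF id \<tau>(2)]])
    ultimately show ?thesis
      using below_stable_words[of m U] by (simp add: m_def U_def finite_words)
  qed
  have flip: "holds_in A21 end_add end_mul (t, s)" if "holds_in A21 end_add end_mul (s, t)" for s t
    using that by (simp add: holds_in_def)
  have axioms: "(\<forall>w\<in>words (subst \<sigma> s). p @ w @ q \<in> stable_words m)
      = (\<forall>w\<in>words (subst \<sigma> t). p @ w @ q \<in> stable_words m)" if "(s, t) \<in> \<Sigma>" for s t \<sigma> p q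
    using step[of s t \<sigma> p q] step[of t s \<sigma> p q] N[OF that] assms(2) that flip by blast
  have "[] \<notin> critical_words m" by (auto simp: critical_words_def marked_word_def m_def)
  then obtain s where s: "words s = critical_words m"
    using ex_term_words[OF finite_critical_words[of m]] by (auto simp: critical_words_def)
  obtain t where t: "words t = {[0..<m] @ [0..<m]}"
    using ex_term_word[of "[0..<m] @ [0..<m]"] by (auto simp: m_def)
  have "\<not> derivable \<Sigma> (s, Plus s t)"
  proof
    assume "derivable \<Sigma> (s, Plus s t)"
    from derivable_context_invariant[OF axioms this, of "[]" "[]"]
    have "[0..<m] @ [0..<m] \<in> stable_words m"
      using s t critical_words_stable[of m] by (auto simp: m_def)
    then show False using square_not_stable[of m] by (simp add: m_def)
  qed
  then show ?thesis using critical_identity_holds[OF _ s t] by (auto simp: m_def)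
qed

theorem theorem6p2:
  shows "\<not> finitely_based A21 end_add end_mul \<and> \<not> finitely_based EndC3 end_add end_mul"
proof (intro conjI notI)
  assume "finitely_based A21 end_add end_mul"
  then obtain \<Sigma> where \<Sigma>: "finite \<Sigma>" "\<forall>e\<in>\<Sigma>. holds_in A21 end_add end_mul e"
    "\<forall>e. holds_in A21 end_add end_mul e \<longrightarrow> derivable \<Sigma> e"
    unfolding finitely_based_def by blast
  then show False
    using critical_identity_not_derivable[OF \<Sigma>(1,2)] holds_in_A21_if_EndC3 by blast
next
  assume "finitely_based EndC3 end_add end_mul"
  then obtain \<Sigma> where \<Sigma>: "finite \<Sigma>" "\<forall>e\<in>\<Sigma>. holds_in EndC3 end_add end_mul e"
    "\<forall>e. holds_in EndC3 end_add end_mul e \<longrightarrow> derivable \<Sigma> e"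
    unfolding finitely_based_def by blast
  \<comment> \<open>Identities pass to the subsemiring A21, so the same lemma applies.\<close>
  then have "\<forall>e\<in>\<Sigma>. holds_in A21 end_add end_mul e" using holds_in_A21_if_EndC3 by blast
  then show False using critical_identity_not_derivable[OF \<Sigma>(1)] \<Sigma>(3) by blast
qed

end
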